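(* Let $\Gamma$ be a valued tree with a splitting weighted edge $l$ corresponding to roots with different lengths. Let $\alpha,\beta$ be the endpoints of $l$, and let $\Gamma_1\ni\alpha$ and $\Gamma_2\ni\beta$ be the two graphs into which $\Gamma$ splits when the edge $l$ is deleted. Then $$\mathcal X(\Gamma,\lambda)=\mathcal X(\Gamma_1,\lambda)\,\mathcal X(\Gamma_2,\lambda)-\rho\,\lambda\,\mathcal X(\Gamma_1\backslash\alpha,\lambda)\,\mathcal X(\Gamma_2\backslash\beta,\lambda),$$ where $\rho$ is the ratio of lengths of the roots corresponding to the endpoints $\alpha$ and $\beta$.
   Context: A valued graph has Cartan matrix $K=(k_{ij})$ with $k_{ii}=2$ and, for an edge between $i$ and $j$ with weights $(d_{ij},d_{ji})$, $k_{ij}=-d_{ij}$, $k_{ji}=-d_{ji}$ (and $k_{ij}=0$ if there is no edge). The matrix $K$ is symmetrizable: $k_{ij}=2(\alpha_i,\alpha_j)/(\alpha_i,\alpha_i)$ for a symmetric bilinear form on the span of the simple roots $\alpha_i$, and the simple roots at the two ends of a weighted edge are compared by their lengths with respect to this form. In the applications of the formula made in the source, the value taken for $\rho$ is $2$ for an edge of type $(1,2)$ or $(2,1)$ (for instance in $F_4$ and $B_n$) and $3$ for an edge of type $(1,3)$ or $(3,1)$ (in the extended diagrams of $G_2$). $\mathcal X(\Gamma,\lambda)=\det({\bf C}-\lambda I)$ is the characteristic polynomial of a Coxeter transformation ${\bf C}$ of $\Gamma$: the product of all simple reflections $\sigma_v(z)=z-(Kz)_v\alpha_v$, each taken once, in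 some order (for a tree or forest $\mathcal X$ does not depend on the order). $\Gamma_i\backslash v$ is $\Gamma_i$ with the vertex $v$ and its incident edges removed; $\mathcal X$ of the empty graph is $1$.
   Formalization: One of the two weights of the edge l is assumed to be 1, and ρ is the ratio of squared lengths, longer over shorter; for other weights the formula fails, e.g. for two vertices with weights (2,4) the coefficient is 8, not 2. *)

theory Defs
  imports Complex_Main "Jordan_Normal_Form.Char_Poly"
begin

text \<open>
  The pair of weights of an edge between \<open>i\<close> and \<open>j\<close> is \<open>(wt G i j, wt G j i)\<close>; weight 0 means
  that there is no edge. Values of \<open>wt\<close> on the diagonal or outside \<open>verts\<close> are ignored.
\<close>

record 'v valued_graph =
  verts :: "'v set"
  wt :: "'v \<Rightarrow> 'v \<Rightarrow> nat"

definition valued_graph :: "'v valued_graph \<Rightarrow> bool" where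
  "valued_graph G \<longleftrightarrow> finite (verts G) \<and>
     (\<forall>i\<in>verts G. \<forall>j\<in>verts G. i \<noteq> j \<longrightarrow> (wt G i j = 0 \<longleftrightarrow> wt G j i = 0))"

definition adj :: "'v valued_graph \<Rightarrow> 'v \<Rightarrow> 'v \<Rightarrow> bool" where
  "adj G i j \<longleftrightarrow> i \<in> verts G \<and> j \<in> verts G \<and> i \<noteq> j \<and> wt G i j \<noteq> 0"

definition is_cycle :: "'v valued_graph \<Rightarrow> 'v list \<Rightarrow> bool" where
  "is_cycle G cs \<longleftrightarrow> 3 \<le> length cs \<and> distinct cs \<and>
     (\<forall>i<length cs. adj G (cs ! i) (cs ! (Suc i mod length cs)))"

definition valued_tree :: "'v valued_graph \<Rightarrow> bool" where
  "valued_tree G \<longleftrightarrow> valued_graph G \<and> verts G \<noteq> {} \<and>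
     (\<forall>u\<in>verts G. \<forall>v\<in>verts G. (adj G)\<^sup>*\<^sup>* u v) \<and> (\<nexists>cs. is_cycle G cs)"

definition delete_edge :: "'v valued_graph \<Rightarrow> 'v \<Rightarrow> 'v \<Rightarrow> 'v valued_graph" where
  "delete_edge G a b =
     G\<lparr>wt := (\<lambda>i j. if (i = a \<and> j = b) \<or> (i = b \<and> j = a) then 0 else wt G i j)\<rparr>"

definition delete_vertex :: "'v valued_graph \<Rightarrow> 'v \<Rightarrow> 'v valued_graph" where
  "delete_vertex G v = G\<lparr>verts := verts G - {v}\<rparr>"

definition component :: "'v valued_graph \<Rightarrow> 'v \<Rightarrow> 'v valued_graph" where
  "component G v = G\<lparr>verts := {u \<in> verts G. (adj G)\<^sup>*\<^sup>* v u}\<rparr>"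

definition splitting_edge :: "'v valued_graph \<Rightarrow> 'v \<Rightarrow> 'v \<Rightarrow> bool" where
  "splitting_edge G a b \<longleftrightarrow> adj G a b \<and> \<not> (adj (delete_edge G a b))\<^sup>*\<^sup>* a b"

definition weighted_edge :: "'v valued_graph \<Rightarrow> 'v \<Rightarrow> 'v \<Rightarrow> bool" where
  "weighted_edge G a b \<longleftrightarrow> adj G a b \<and> \<not> (wt G a b = 1 \<and> wt G b a = 1)"

definition cartan :: "'v valued_graph \<Rightarrow> 'v \<Rightarrow> 'v \<Rightarrow> real" where
  "cartan G i j = (if i = j then 2 else - real (wt G i j))"

text \<open>
  \<open>B i j\<close> is the value \<open>(\<alpha>\<^sub>i, \<alpha>\<^sub>j)\<close> of a symmetric bilinear form on the basis of simple roots.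
  The squared lengths \<open>(\<alpha>\<^sub>i, \<alpha>\<^sub>i)\<close> are positive, but the form need not be positive definite.
\<close>

definition symmetrizing_form :: "'v valued_graph \<Rightarrow> ('v \<Rightarrow> 'v \<Rightarrow> real) \<Rightarrow> bool" where
  "symmetrizing_form G B \<longleftrightarrow>
     (\<forall>i\<in>verts G. 0 < B i i) \<and>
     (\<forall>i\<in>verts G. \<forall>j\<in>verts G. B i j = B j i) \<and>
     (\<forall>i\<in>verts G. \<forall>j\<in>verts G. cartan G i j = 2 * B i j / B i i)"

text \<open>
  Lengths enter through their squares, the longer root over the shorter one, so that the ratio is
  \<open>d\<close> for an edge with weights \<open>(1, d)\<close> or \<open>(d, 1)\<close>.
\<close>

definition length_ratio :: "('v \<Rightarrow> 'v \<Rightarrow> real) \<Rightarrow> 'v \<Rightarrow> 'v \<Rightarrow> real" where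
  "length_ratio B a b = max (B a a) (B b b) / min (B a a) (B b b)"

text \<open>
  A vector \<open>z\<close> of the span of the simple roots is given by its coordinate function.
\<close>

definition simple_root :: "'v \<Rightarrow> 'v \<Rightarrow> real" where
  "simple_root v = (\<lambda>u. if u = v then 1 else 0)"

definition reflection :: "'v valued_graph \<Rightarrow> 'v \<Rightarrow> ('v \<Rightarrow> real) \<Rightarrow> ('v \<Rightarrow> real)" where
  "reflection G v z = (\<lambda>u. z u - (\<Sum>w\<in>verts G. cartan G v w * z w) * simple_root v u)"

definition vertex_order :: "'v valued_graph \<Rightarrow> 'v list \<Rightarrow> bool" where
  "vertex_order G vs \<longleftrightarrow> distinct vs \<and> set vs = verts G"

definition coxeter :: "'v valued_graph \<Rightarrow> 'v list \<Rightarrow> ('v \<Rightarrow> real) \<Rightarrow> ('v \<Rightarrow> real)" where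
  "coxeter G vs = foldr (\<lambda>v f. reflection G v \<circ> f) vs id"

text \<open>
  The list \<open>vs\<close> serves both as the order of the reflections and as the enumeration of the basis of
  simple roots with respect to which the matrix is written; the latter does not affect the
  determinant.
\<close>

definition coxeter_matrix :: "'v valued_graph \<Rightarrow> 'v list \<Rightarrow> real mat" where
  "coxeter_matrix G vs =
     mat (length vs) (length vs) (\<lambda>(i, j). coxeter G vs (simple_root (vs ! j)) (vs ! i))"

text \<open>
  The sign convention is \<open>det (C - \<lambda>I)\<close>, which differs from \<^const>\<open>char_poly\<close> by \<open>(-1)^n\<close>;
  the indeterminate \<open>\<lambda>\<close> is \<open>[:0, 1:]\<close>.
\<close>

definition cox_poly :: "'v valued_graph \<Rightarrow> 'v list \<Rightarrow> real poly" where
  "cox_poly G vs =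
     det (map_mat (\<lambda>a. [:a:]) (coxeter_matrix G vs) - [:0, 1:] \<cdot>\<^sub>m 1\<^sub>m (length vs))"

end

theory Submission
  imports Defs "HOL-Combinatorics.Cycles"
begin

text \<open>
  Write the Cartan matrix as \<open>K = L + U\<close> with \<open>U\<close> upper and \<open>L\<close> lower triangular, both with unit
  diagonal, relative to the order of the reflections. The product of the reflections replaces the
  coordinates one after the other, from the last to the first, so its matrix satisfies
  \<open>U C = - L\<close>, as in a Gauss--Seidel sweep. Since \<open>det U = 1\<close>, the Coxeter polynomial
  \<open>det (C - \<lambda>I)\<close> equals \<open>det (- (L + \<lambda>U))\<close> (\<open>cox_poly_eq_set_det\<close>).

  In the Leibniz expansion of this determinant a permutation with a cycle of length at least three
  contributes nothing when the graph is a forest. Only involutions remain, and these see the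
  off-diagonal entries through the products \<open>d\<^sub>i\<^sub>j d\<^sub>j\<^sub>i \<lambda>\<close> of opposite entries, in which the order
  has disappeared (\<open>set_det_cong_acyclic\<close>). Hence the five polynomials in the formula, each
  given with its own order, are all principal minors of one and the same matrix, the one that belongs to the
  order chosen for the whole tree (\<open>cox_poly_subgraph\<close>).

  The formula is then a statement about determinants (\<open>set_det_two_blocks_one_edge\<close>). The vertex
  sets of the two parts give a matrix with two diagonal blocks, outside of which only the entries
  at \<open>(\<alpha>, \<beta>)\<close> and \<open>(\<beta>, \<alpha>)\<close> can be nonzero. A contributing permutation either
  preserves both blocks, which gives the product of the two determinants, or it exchanges \<open>\<alpha>\<close> and
  \<open>\<beta>\<close> and preserves what is left of each block, which gives the correction term with factor
  \<open>- d\<^sub>\<alpha>\<^sub>\<beta> d\<^sub>\<beta>\<^sub>\<alpha> \<lambda>\<close>. Finally, symmetry of the form gives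
  \<open>d\<^sub>\<alpha>\<^sub>\<beta> (\<alpha>, \<alpha>) = d\<^sub>\<beta>\<^sub>\<alpha> (\<beta>, \<beta>)\<close>, so that with one of the weights equal to 1 the product
  \<open>d\<^sub>\<alpha>\<^sub>\<beta> d\<^sub>\<beta>\<^sub>\<alpha>\<close> is the ratio of the squared lengths (\<open>length_ratio_eq_weight_prod\<close>).
\<close>

section \<open>Determinants indexed by a finite set\<close>

text \<open>
  The Leibniz formula, indexed by a set instead of an initial segment of the natural numbers: deleting
  vertices of a graph then means passing to a smaller set, and no basis has to be renumbered.
\<close>

definition set_det :: "'a set \<Rightarrow> ('a \<Rightarrow> 'a \<Rightarrow> 'r) \<Rightarrow> 'r :: comm_ring_1" where
  "set_det S M = (\<Sum>p | p permutes S. of_int (sign p) * (\<Prod>i\<in>S. M i (p i)))"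

lemma set_det_cong:
  assumes "\<And>i j. i \<in> S \<Longrightarrow> j \<in> S \<Longrightarrow> M i j = M' i j"
  shows "set_det S M = set_det S M'"
  unfolding set_det_def
  by (intro sum.cong prod.cong arg_cong2[of _ _ _ _ "(*)"] refl)
     (use assms in \<open>auto simp: permutes_in_image\<close>)

lemma det_eq_set_det:
  fixes M :: "'a \<Rightarrow> 'a \<Rightarrow> 'r :: comm_ring_1"
  assumes "distinct vs"
  shows "det (mat (length vs) (length vs) (\<lambda>(i, j). M (vs ! i) (vs ! j))) = set_det (set vs) M"
proof -
  let ?I = "{0..<length vs}"
  let ?m = "map_permutation ?I ((!) vs)"
  have bij: "bij_betw ((!) vs) ?I (set vs)"
    using assms by (intro bij_betw_nth) auto
  then have inj: "inj_on ((!) vs) ?I"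
    by (rule bij_betw_imp_inj_on)
  have img: "(!) vs ` ?I = set vs"
    using bij by (rule bij_betw_imp_surj_on)
  have bij': "bij_betw ?m {p. p permutes ?I} {p. p permutes set vs}"
    using bij_betw_permutations[OF bij]
    unfolding map_permutation_def restrict_id_def img o_def .
  have "set_det (set vs) M
      = (\<Sum>p | p permutes ?I. of_int (sign (?m p)) * (\<Prod>v\<in>set vs. M v (?m p v)))"
    unfolding set_det_def by (rule sum.reindex_bij_betw[OF bij', symmetric])
  also have "\<dots> = (\<Sum>p | p permutes ?I. of_int (sign p) * (\<Prod>i\<in>?I. M (vs ! i) (vs ! p i)))"
  proof (rule sum.cong[OF refl])
    fix p assume "p \<in> {p. p permutes ?I}"
    then have p: "p permutes ?I" by simp
    have "sign (?m p) = sign p"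
      using p inj by (simp add: sign_map_permutation)
    moreover have "(\<Prod>v\<in>set vs. M v (?m p v)) = (\<Prod>i\<in>?I. M (vs ! i) (?m p (vs ! i)))"
      by (rule prod.reindex_bij_betw[OF bij, symmetric])
    moreover have "\<dots> = (\<Prod>i\<in>?I. M (vs ! i) (vs ! p i))"
      by (rule prod.cong) (auto simp: map_permutation_apply[OF inj])
    ultimately show "of_int (sign (?m p)) * (\<Prod>v\<in>set vs. M v (?m p v))
        = of_int (sign p) * (\<Prod>i\<in>?I. M (vs ! i) (vs ! p i))" by simp
  qed
  also have "\<dots> = det (mat (length vs) (length vs) (\<lambda>(i, j). M (vs ! i) (vs ! j)))"
    by (subst det_def'[of _ "length vs"])
       (auto intro!: sum.cong prod.cong simp: permutes_in_image[of _ "{0..<length vs}", simplified])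
  finally show ?thesis ..
qed

text \<open>
  A permutation that meets no entry of the zero block maps \<open>S\<close> into itself, and so, by finiteness, it
  preserves both \<open>S\<close> and \<open>T\<close> and is a permutation of \<open>S\<close> composed with one of \<open>T\<close>.
\<close>

lemma set_det_block:
  fixes M :: "'a \<Rightarrow> 'a \<Rightarrow> 'r :: comm_ring_1"
  assumes fin: "finite S" "finite T" and disj: "S \<inter> T = {}"
    and zero: "\<And>u v. u \<in> S \<Longrightarrow> v \<in> T \<Longrightarrow> M u v = 0"
  shows "set_det (S \<union> T) M = set_det S M * set_det T M"
proof -
  let ?P = "{p. p permutes S} \<times> {q. q permutes T}"
  let ?h = "\<lambda>(p, q). p \<circ> q :: 'a \<Rightarrow> 'a"
  let ?f = "\<lambda>p. of_int (sign p) * (\<Prod>i\<in>S \<union> T. M i (p i))"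
  have h_S: "(p \<circ> q) u = p u" if "q permutes T" "u \<in> S" for p q u
  proof -
    have "u \<notin> T" using that disj by auto
    then show ?thesis using that by (simp add: permutes_not_in)
  qed
  have h_T: "(p \<circ> q) u = q u" if "p permutes S" "q permutes T" "u \<in> T" for p q u
  proof -
    have "q u \<in> T" using that by (simp add: permutes_in_image)
    then have "q u \<notin> S" using disj by auto
    then show ?thesis using that by (simp add: permutes_not_in)
  qed
  have inj: "inj_on ?h ?P"
  proof (rule inj_onI, clarify)
    fix p q p' q'
    assume *: "p permutes S" "q permutes T" "p' permutes S" "q' permutes T" "p \<circ> q = p' \<circ> q'"
    have "p u = p' u" for u
      using h_S[of q u p] h_S[of q' u p'] * by (cases "u \<in> S") (auto simp: permutes_not_in)
    moreover have "q u = q' u" for u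
      using h_T[of p q u] h_T[of p' q' u] * by (cases "u \<in> T") (auto simp: permutes_not_in)
    ultimately show "p = p' \<and> q = q'" by auto
  qed
  have "set_det S M * set_det T M = (\<Sum>(p, q)\<in>?P. (of_int (sign p) * (\<Prod>i\<in>S. M i (p i)))
      * (of_int (sign q) * (\<Prod>i\<in>T. M i (q i))))"
    unfolding set_det_def by (simp add: sum_product sum.cartesian_product)
  also have "\<dots> = (\<Sum>pq\<in>?P. ?f (?h pq))"
  proof (rule sum.cong[OF refl], clarify)
    fix p q assume pq: "p permutes S" "q permutes T"
    have "sign (p \<circ> q) = sign p * sign q"
      using pq fin by (intro sign_compose) (auto intro: permutation_permutes[THEN iffD2])
    moreover have "(\<Prod>i\<in>S \<union> T. M i ((p \<circ> q) i))
        = (\<Prod>i\<in>S. M i ((p \<circ> q) i)) * (\<Prod>i\<in>T. M i ((p \<circ> q) i))"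
      using fin disj by (rule prod.union_disjoint)
    moreover have "(\<Prod>i\<in>S. M i ((p \<circ> q) i)) = (\<Prod>i\<in>S. M i (p i))"
      using h_S[OF pq(2)] by (intro prod.cong) auto
    moreover have "(\<Prod>i\<in>T. M i ((p \<circ> q) i)) = (\<Prod>i\<in>T. M i (q i))"
      using h_T[OF pq] by (intro prod.cong) auto
    ultimately show "of_int (sign p) * (\<Prod>i\<in>S. M i (p i)) * (of_int (sign q) * (\<Prod>i\<in>T. M i (q i)))
        = of_int (sign (p \<circ> q)) * (\<Prod>i\<in>S \<union> T. M i ((p \<circ> q) i))"
      by (simp add: ac_simps)
  qed
  also have "\<dots> = sum ?f (?h ` ?P)"
    by (rule sum.reindex_cong[OF inj refl refl, symmetric])
  also have "\<dots> = sum ?f {p. p permutes S \<union> T}"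
  proof (rule sum.mono_neutral_left)
    show "finite {p. p permutes S \<union> T}" using fin by (simp add: finite_permutations)
    show "?h ` ?P \<subseteq> {p. p permutes S \<union> T}"
      by (auto intro!: permutes_compose intro: permutes_subset)
    show "\<forall>p\<in>{p. p permutes S \<union> T} - ?h ` ?P. ?f p = 0"
    proof (rule ballI, rule ccontr)
      fix p assume p: "p \<in> {p. p permutes S \<union> T} - ?h ` ?P" and nz: "?f p \<noteq> 0"
      from p have perm: "p permutes S \<union> T" by simp
      have nz_u: "M u (p u) \<noteq> 0" if "u \<in> S \<union> T" for u
        using nz that fin by (metis finite_Un mult_zero_right prod_zero)
      have "p ` S \<subseteq> S"
      proof (rule image_subsetI)
        fix u assume u: "u \<in> S"
        then have "p u \<in> S \<union> T" using permutes_in_image[OF perm, of u] by simp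
        moreover have "p u \<notin> T" using zero[of u "p u"] nz_u[of u] u by auto
        ultimately show "p u \<in> S" by simp
      qed
      then have pS: "p ` S = S"
        using fin perm by (intro endo_inj_surj) (auto intro: permutes_inj_on)
      have pT: "p ` T = T"
      proof -
        have "p ` T = p ` (S \<union> T) - p ` S"
          using disj permutes_inj[OF perm] by (auto simp: inj_def)
        also have "\<dots> = T" using permutes_image[OF perm] pS disj by auto
        finally show ?thesis .
      qed
      have "restrict_id p S permutes S" "restrict_id p T permutes T"
        using pS pT perm by (auto intro!: permutes_restrict_id simp: bij_betw_def intro: permutes_inj_on)
      moreover have "p = restrict_id p S \<circ> restrict_id p T"
        using pS pT disj perm by (fastforce simp: restrict_id_def permutes_not_in)
      ultimately have "p \<in> ?h ` ?P" by (auto intro!: image_eqI[of _ _ "(restrict_id p S, restrict_id p T)"])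
      with p show False by simp
    qed
  qed
  finally show ?thesis unfolding set_det_def ..
qed

text \<open>
  A permutation that exchanges \<open>a\<close> and \<open>b\<close> is the transposition of \<open>a\<close> and \<open>b\<close> after a permutation
  of the remaining elements; the transposition accounts for the sign.
\<close>

lemma sum_permutes_swapping:
  fixes M :: "'a \<Rightarrow> 'a \<Rightarrow> 'r :: comm_ring_1"
  assumes fin: "finite S" and ab: "a \<in> S" "b \<in> S" "a \<noteq> b"
  shows "(\<Sum>p | p permutes S \<and> p a = b \<and> p b = a. of_int (sign p) * (\<Prod>i\<in>S. M i (p i)))
    = - (M a b * M b a * set_det (S - {a, b}) M)"
proof -
  let ?R = "S - {a, b}" and ?t = "transpose a b"
  have t: "?t permutes S" using ab by (simp add: permutes_swap_id)
  have bij: "bij_betw (\<lambda>q. ?t \<circ> q) {q. q permutes ?R} {p. p permutes S \<and> p a = b \<and> p b = a}"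
  proof (rule bij_betw_byWitness[where f' = "\<lambda>p. ?t \<circ> p"])
    show "(\<lambda>q. ?t \<circ> q) ` {q. q permutes ?R} \<subseteq> {p. p permutes S \<and> p a = b \<and> p b = a}"
    proof clarify
      fix q assume q: "q permutes ?R"
      then have "q permutes S" by (rule permutes_subset) auto
      with q t show "?t \<circ> q permutes S \<and> (?t \<circ> q) a = b \<and> (?t \<circ> q) b = a"
        by (auto intro: permutes_compose simp: permutes_not_in)
    qed
    show "(\<lambda>p. ?t \<circ> p) ` {p. p permutes S \<and> p a = b \<and> p b = a} \<subseteq> {q. q permutes ?R}"
    proof (rule image_subsetI)
      fix p assume "p \<in> {p. p permutes S \<and> p a = b \<and> p b = a}"
      then have p: "p permutes S" "p a = b" "p b = a" by auto
      then have "?t \<circ> p permutes S" using t by (auto intro: permutes_compose)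
      then have "?t \<circ> p permutes ?R" by (rule permutes_superset) (use p in auto)
      then show "?t \<circ> p \<in> {q. q permutes ?R}" by simp
    qed
  qed (auto simp: comp_assoc[symmetric])
  have "(\<Sum>p | p permutes S \<and> p a = b \<and> p b = a. of_int (sign p) * (\<Prod>i\<in>S. M i (p i)))
      = (\<Sum>q | q permutes ?R. of_int (sign (?t \<circ> q)) * (\<Prod>i\<in>S. M i ((?t \<circ> q) i)))"
    by (rule sum.reindex_bij_betw[OF bij, symmetric])
  also have "\<dots> = (\<Sum>q | q permutes ?R. - (M a b * M b a) * (of_int (sign q) * (\<Prod>i\<in>?R. M i (q i))))"
  proof (rule sum.cong[OF refl], clarify)
    fix q assume q: "q permutes ?R"
    have "permutation q" using q fin by (auto intro: permutation_permutes[THEN iffD2])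
    then have sgn: "sign (?t \<circ> q) = - sign q"
      using ab by (simp add: sign_compose permutation_swap_id sign_swap_id)
    have q_ab: "q a = a" "q b = b" using q by (auto simp: permutes_not_in)
    have "S = insert a (insert b ?R)" using ab by auto
    then have "(\<Prod>i\<in>S. M i ((?t \<circ> q) i)) = (\<Prod>i\<in>insert a (insert b ?R). M i ((?t \<circ> q) i))"
      by simp
    also have "\<dots> = M a b * M b a * (\<Prod>i\<in>?R. M i ((?t \<circ> q) i))"
      using fin ab q_ab by (simp add: mult.assoc)
    also have "(\<Prod>i\<in>?R. M i ((?t \<circ> q) i)) = (\<Prod>i\<in>?R. M i (q i))"
    proof (rule prod.cong[OF refl])
      fix i assume "i \<in> ?R"
      then have "q i \<in> ?R" using q by (simp only: permutes_in_image)
      then show "M i ((?t \<circ> q) i) = M i (q i)" by (simp add: transpose_def)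
    qed
    finally show "of_int (sign (?t \<circ> q)) * (\<Prod>i\<in>S. M i ((?t \<circ> q) i))
        = - (M a b * M b a) * (of_int (sign q) * (\<Prod>i\<in>?R. M i (q i)))"
      by (simp add: sgn ac_simps)
  qed
  finally show ?thesis by (simp add: set_det_def sum_distrib_left sum_negf)
qed

text \<open>
  The permutations are separated according to whether they send \<open>a\<close> to \<open>b\<close>. Those that do not cannot
  tell \<open>M\<close> from the block triangular matrix in which the entry at \<open>(a, b)\<close> is replaced by 0. Those
  that do leave \<open>S\<close>, hence have to come back from \<open>T\<close> to \<open>S\<close>, which is possible only from \<open>b\<close> to \<open>a\<close>.
\<close>

lemma set_det_two_blocks_one_edge:
  fixes M :: "'a \<Rightarrow> 'a \<Rightarrow> 'r :: comm_ring_1"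
  assumes fin: "finite S" "finite T" and disj: "S \<inter> T = {}" and ab: "a \<in> S" "b \<in> T"
    and zero: "\<And>u v. u \<in> S \<Longrightarrow> v \<in> T \<Longrightarrow> (u, v) \<noteq> (a, b) \<Longrightarrow> M u v = 0 \<and> M v u = 0"
  shows "set_det (S \<union> T) M
    = set_det S M * set_det T M - M a b * M b a * set_det (S - {a}) M * set_det (T - {b}) M"
proof -
  let ?f = "\<lambda>M p. of_int (sign p) * (\<Prod>i\<in>S \<union> T. M i (p i)) :: 'r"
  let ?A = "{p. p permutes S \<union> T}"
  let ?A1 = "{p. p permutes S \<union> T \<and> p a \<noteq> b}" and ?A2 = "{p. p permutes S \<union> T \<and> p a = b}"
  let ?A3 = "{p. p permutes S \<union> T \<and> p a = b \<and> p b = a}"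
  define M0 where "M0 = (\<lambda>u v. if u = a \<and> v = b then 0 else M u v)"
  have finA: "finite ?A" using fin by (simp add: finite_permutations)
  have fin1: "finite ?A1" by (rule finite_subset[OF _ finA]) auto
  have fin2: "finite ?A2" by (rule finite_subset[OF _ finA]) auto
  have "set_det (S \<union> T) M = sum (?f M) (?A1 \<union> ?A2)"
    unfolding set_det_def by (rule sum.cong) auto
  also have "\<dots> = sum (?f M) ?A1 + sum (?f M) ?A2"
    using fin1 fin2 by (rule sum.union_disjoint) auto
  also have "sum (?f M) ?A1 = sum (?f M0) ?A1"
    by (rule sum.cong[OF refl], rule arg_cong2[of _ _ _ _ "(*)"], rule refl, rule prod.cong)
       (auto simp: M0_def)
  also have "sum (?f M0) ?A1 = set_det (S \<union> T) M0"
    unfolding set_det_def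
  proof (rule sum.mono_neutral_left[OF finA], blast, rule ballI)
    fix p assume "p \<in> ?A - ?A1"
    then have "p a = b" by auto
    have "M0 a (p a) = 0" using \<open>p a = b\<close> by (simp add: M0_def)
    then have "(\<Prod>i\<in>S \<union> T. M0 i (p i)) = 0"
      using fin ab by (intro prod_zero) auto
    then show "?f M0 p = 0" by simp
  qed
  also have "set_det (S \<union> T) M0 = set_det S M0 * set_det T M0"
    using fin disj zero by (intro set_det_block) (auto simp: M0_def)
  also have "set_det S M0 = set_det S M"
    using disj ab by (intro set_det_cong) (auto simp: M0_def)
  also have "set_det T M0 = set_det T M"
    using disj ab by (intro set_det_cong) (auto simp: M0_def)
  also have "sum (?f M) ?A2 = sum (?f M) ?A3"
  proof (rule sum.mono_neutral_right[OF fin2], blast, rule ballI, rule ccontr)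
    fix p assume p: "p \<in> ?A2 - ?A3" and nz: "?f M p \<noteq> 0"
    then have perm: "p permutes S \<union> T" and "p a = b" "p b \<noteq> a" by auto
    have nz_u: "M u (p u) \<noteq> 0" if "u \<in> S \<union> T" for u
      using nz that fin by (metis finite_Un mult_zero_right prod_zero)
    \<comment> \<open>If \<open>b\<close> is not sent to \<open>a\<close>, nothing leaves \<open>T\<close>; so \<open>T\<close> is mapped onto itself and cannot also
      receive \<open>a\<close>.\<close>
    have "p ` T \<subseteq> T"
    proof (rule image_subsetI)
      fix u assume u: "u \<in> T"
      then have "p u \<in> S \<union> T" using permutes_in_image[OF perm, of u] by simp
      moreover have "p u \<notin> S" using zero[of "p u" u] nz_u[of u] u \<open>p b \<noteq> a\<close> by auto
      ultimately show "p u \<in> T" by simp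
    qed
    then have "p ` T = T"
      using fin perm by (intro endo_inj_surj) (auto intro: permutes_inj_on)
    then have "b \<in> p ` T" using ab by simp
    then obtain y where "y \<in> T" "p y = b" by auto
    then have "y = a" using \<open>p a = b\<close> permutes_inj[OF perm] by (metis injD)
    then show False using \<open>y \<in> T\<close> ab disj by auto
  qed
  also have "sum (?f M) ?A3 = - (M a b * M b a * set_det (S \<union> T - {a, b}) M)"
    using fin ab disj by (intro sum_permutes_swapping) auto
  also have "S \<union> T - {a, b} = (S - {a}) \<union> (T - {b})" using ab disj by auto
  also have "set_det \<dots> M = set_det (S - {a}) M * set_det (T - {b}) M"
    using fin disj zero by (intro set_det_block) auto
  finally show ?thesis by (simp add: mult.assoc)
qed

section \<open>Determinants of matrices without long cycles\<close>

text \<open>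
  The product over \<open>S\<close> is grouped by the orbits \<open>{i, p i}\<close> of the involution. An orbit contributes a
  diagonal entry if it is a singleton and a product of two opposite entries otherwise.
\<close>

lemma involution_prod_cong:
  fixes M M' :: "'a \<Rightarrow> 'a \<Rightarrow> 'r :: comm_monoid_mult"
  assumes fin: "finite S" and inv: "\<And>u. u \<in> S \<Longrightarrow> p u \<in> S \<and> p (p u) = u"
    and diag: "\<And>u. u \<in> S \<Longrightarrow> M u u = M' u u"
    and pairs: "\<And>u v. u \<in> S \<Longrightarrow> v \<in> S \<Longrightarrow> u \<noteq> v \<Longrightarrow> M u v * M v u = M' u v * M' v u"
  shows "(\<Prod>i\<in>S. M i (p i)) = (\<Prod>i\<in>S. M' i (p i))"
proof -
  let ?o = "\<lambda>i. {i, p i}"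
  have split: "(\<Prod>i\<in>S. N i (p i)) = (\<Prod>y\<in>?o ` S. \<Prod>i | i \<in> S \<and> ?o i = y. N i (p i))"
    for N :: "'a \<Rightarrow> 'a \<Rightarrow> 'r"
    using fin by (intro prod.group[symmetric]) auto
  have orbit: "(\<Prod>i | i \<in> S \<and> ?o i = ?o u. M i (p i)) = (\<Prod>i | i \<in> S \<and> ?o i = ?o u. M' i (p i))"
    if u: "u \<in> S" for u
  proof -
    have "{i. i \<in> S \<and> ?o i = ?o u} = {u, p u}"
      using inv u by (auto simp: doubleton_eq_iff)
    then show ?thesis
      using u inv[OF u] diag[of u] pairs[of u "p u"] by (cases "p u = u") auto
  qed
  have "(\<Prod>y\<in>?o ` S. \<Prod>i | i \<in> S \<and> ?o i = y. M i (p i))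
      = (\<Prod>y\<in>?o ` S. \<Prod>i | i \<in> S \<and> ?o i = y. M' i (p i))"
  proof (rule prod.cong[OF refl])
    fix y assume "y \<in> ?o ` S"
    then obtain u where "u \<in> S" "y = ?o u" by auto
    then show "(\<Prod>i | i \<in> S \<and> ?o i = y. M i (p i)) = (\<Prod>i | i \<in> S \<and> ?o i = y. M' i (p i))"
      using orbit by simp
  qed
  then show ?thesis using split[of M] split[of M'] by simp
qed

text \<open>
  For a permutation that is not an involution, the orbit of a point with \<open>p (p u) \<noteq> u\<close> is a closed
  walk through at least three distinct indices, so one of its entries vanishes in both matrices.
  For involutions the terms agree by \<open>involution_prod_cong\<close>.
\<close>

lemma set_det_cong_acyclic:
  fixes M M' :: "'a \<Rightarrow> 'a \<Rightarrow> 'r :: comm_ring_1"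
  assumes fin: "finite S"
    and acyclic: "\<And>cs. 3 \<le> length cs \<Longrightarrow> distinct cs \<Longrightarrow> set cs \<subseteq> S \<Longrightarrow>
      \<exists>i<length cs. M (cs ! i) (cs ! (Suc i mod length cs)) = 0
                  \<and> M' (cs ! i) (cs ! (Suc i mod length cs)) = 0"
    and diag: "\<And>u. u \<in> S \<Longrightarrow> M u u = M' u u"
    and pairs: "\<And>u v. u \<in> S \<Longrightarrow> v \<in> S \<Longrightarrow> u \<noteq> v \<Longrightarrow> M u v * M v u = M' u v * M' v u"
  shows "set_det S M = set_det S M'"
  unfolding set_det_def
proof (rule sum.cong[OF refl], clarify)
  fix p assume p: "p permutes S"
  then have perm: "permutation p" using fin by (auto simp: permutation_permutes)
  show "of_int (sign p) * (\<Prod>i\<in>S. M i (p i)) = of_int (sign p) * (\<Prod>i\<in>S. M' i (p i))"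
  proof (cases "\<forall>u\<in>S. p (p u) = u")
    case True
    then have "(\<Prod>i\<in>S. M i (p i)) = (\<Prod>i\<in>S. M' i (p i))"
      using p by (intro involution_prod_cong fin diag pairs) (auto simp: permutes_in_image)
    then show ?thesis by simp
  next
    case False
    then obtain u where u: "u \<in> S" "p (p u) \<noteq> u" by auto
    let ?n = "least_power p u" and ?cs = "support p u"
    have pow: "(p ^^ ?n) u = u" "?n > 0" using least_power_of_permutation[OF perm] by auto
    have "?n \<noteq> 1" "?n \<noteq> 2" using pow u by (auto simp: numeral_2_eq_2)
    then have "3 \<le> length ?cs" using pow by simp
    moreover have "distinct ?cs" using cycle_of_permutation[OF perm] .
    moreover have in_S: "(p ^^ i) u \<in> S" for i
      using p u by (induction i) (auto simp: permutes_in_image)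
    then have "set ?cs \<subseteq> S" by auto
    ultimately obtain i where i: "i < length ?cs" "M (?cs ! i) (?cs ! (Suc i mod length ?cs)) = 0"
        "M' (?cs ! i) (?cs ! (Suc i mod length ?cs)) = 0"
      using acyclic by blast
    have "?cs ! (Suc i mod length ?cs) = p (?cs ! i)"
    proof (cases "Suc i = ?n")
      case True
      then have "p ((p ^^ i) u) = u" using pow by (metis comp_apply funpow.simps(2))
      then show ?thesis using True pow i by simp
    next
      case False
      then show ?thesis using i by simp
    qed
    with i in_S have "M ((p ^^ i) u) (p ((p ^^ i) u)) = 0" "M' ((p ^^ i) u) (p ((p ^^ i) u)) = 0"
      by auto
    then have "(\<Prod>i\<in>S. M i (p i)) = 0" "(\<Prod>i\<in>S. M' i (p i)) = 0"
      using in_S fin by (auto intro!: prod_zero)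
    then show ?thesis by simp
  qed
qed

section \<open>The Coxeter polynomial as a determinant\<close>

lemma coxeter_Cons:
  "coxeter G (v # vs) z = reflection G v (coxeter G vs z)"
  by (simp add: coxeter_def)

lemma reflection_other: "u \<noteq> v \<Longrightarrow> reflection G v z u = z u"
  by (simp add: reflection_def simple_root_def)

lemma coxeter_append: "coxeter G (us @ vs) z = coxeter G us (coxeter G vs z)"
  by (induction us) (simp_all add: coxeter_Cons, simp add: coxeter_def)

lemma coxeter_not_in: "u \<notin> set vs \<Longrightarrow> coxeter G vs z u = z u"
  by (induction vs) (auto simp: coxeter_Cons reflection_other, simp add: coxeter_def)

text \<open>
  The reflection at \<open>vs ! i\<close> is applied after those at later positions and before those at earlier ones,
  and it changes only its own coordinate. At that moment the later coordinates already have their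
  final values, while the earlier ones and the \<open>i\<close>-th itself still have their initial values.
\<close>

lemma coxeter_nth:
  assumes order: "vertex_order G vs" and i: "i < length vs"
  shows "coxeter G vs z (vs ! i) = z (vs ! i)
    - (\<Sum>j<length vs. cartan G (vs ! i) (vs ! j)
        * (if i < j then coxeter G vs z (vs ! j) else z (vs ! j)))"
proof -
  have dist: "distinct vs" and set: "set vs = verts G"
    using order by (auto simp: vertex_order_def)
  \<comment> \<open>the vector to which the reflection at \<open>vs ! i\<close> is applied\<close>
  define x where "x = coxeter G (drop (Suc i) vs) z"
  have split: "coxeter G vs z = coxeter G (take i vs) (reflection G (vs ! i) x)"
    using id_take_nth_drop[OF i] coxeter_append coxeter_Cons unfolding x_def by metis
  have x_le: "x (vs ! j) = z (vs ! j)" if "j \<le> i" for j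
    unfolding x_def using that i dist
    by (intro coxeter_not_in) (auto simp: in_set_conv_nth nth_eq_iff_index_eq)
  have take_ge: "vs ! j \<notin> set (take i vs)" if "i \<le> j" "j < length vs" for j
    using that i dist by (auto simp: in_set_conv_nth nth_eq_iff_index_eq)
  have x_gt: "x (vs ! j) = coxeter G vs z (vs ! j)" if "i < j" "j < length vs" for j
    using that i dist take_ge[of j]
    by (simp add: split coxeter_not_in reflection_other nth_eq_iff_index_eq)
  have "coxeter G vs z (vs ! i) = reflection G (vs ! i) x (vs ! i)"
    using take_ge[of i] i by (simp add: split coxeter_not_in)
  also have "\<dots> = x (vs ! i) - (\<Sum>w\<in>set vs. cartan G (vs ! i) w * x w)"
    by (simp add: reflection_def simple_root_def set)
  also have "(\<Sum>w\<in>set vs. cartan G (vs ! i) w * x w)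
      = (\<Sum>j<length vs. cartan G (vs ! i) (vs ! j) * x (vs ! j))"
    using dist by (intro sum.reindex_bij_betw[symmetric] bij_betw_nth) auto
  also have "\<dots> = (\<Sum>j<length vs. cartan G (vs ! i) (vs ! j)
        * (if i < j then coxeter G vs z (vs ! j) else z (vs ! j)))"
    by (rule sum.cong) (auto simp: x_le x_gt)
  finally show ?thesis by (simp add: x_le)
qed

definition before :: "'v list \<Rightarrow> 'v \<Rightarrow> 'v \<Rightarrow> bool" where
  "before vs u w \<longleftrightarrow> (\<exists>i j. i < j \<and> j < length vs \<and> vs ! i = u \<and> vs ! j = w)"

lemma before_nth:
  "distinct vs \<Longrightarrow> i < length vs \<Longrightarrow> j < length vs \<Longrightarrow> before vs (vs ! i) (vs ! j) \<longleftrightarrow> i < j"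
  unfolding before_def by (auto simp: nth_eq_iff_index_eq)

text \<open>
  The entries of \<open>- (L + \<lambda>U)\<close>, where \<open>K = L + U\<close> is the decomposition of the Cartan matrix into
  triangular matrices with unit diagonal, \<open>U\<close> holding the entries \<open>(u, w)\<close> with \<open>u\<close> before \<open>w\<close> in
  \<open>vs\<close>. The polynomial \<open>[:-1, -1:]\<close> on the diagonal is \<open>- (1 + \<lambda>)\<close>.
\<close>

definition cox_entry :: "'v valued_graph \<Rightarrow> 'v list \<Rightarrow> 'v \<Rightarrow> 'v \<Rightarrow> real poly" where
  "cox_entry G vs u w =
     (if u = w then [:-1, -1:]
      else Polynomial.smult (real (wt G u w)) (if before vs u w then [:0, 1:] else 1))"

lemma sum_const_poly: "(\<Sum>i\<in>A. [:f i:]) = [:\<Sum>i\<in>A. f i:]"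
  by (induction A rule: infinite_finite_induct) auto

text \<open>
  By \<open>coxeter_nth\<close>, applied to the simple roots, \<open>U C = - L\<close>. Multiplying \<open>C - \<lambda>I\<close> from the left by
  the unipotent matrix \<open>U\<close> leaves the determinant unchanged and gives \<open>- L - \<lambda>U\<close>.
\<close>

lemma cox_poly_eq_set_det:
  assumes order: "vertex_order G vs"
  shows "cox_poly G vs = set_det (verts G) (cox_entry G vs)"
proof -
  let ?n = "length vs"
  let ?k = "\<lambda>i j. cartan G (vs ! i) (vs ! j)"
  have dist: "distinct vs" and set: "set vs = verts G"
    using order by (auto simp: vertex_order_def)
  define u where "u = (\<lambda>i j. if i = j then 1 else if i < j then ?k i j else 0)"
  define c where "c = (\<lambda>i j. coxeter G vs (simple_root (vs ! j)) (vs ! i))"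
  have root: "simple_root (vs ! l) (vs ! j) = (if j = l then 1 else 0)" if "j < ?n" "l < ?n" for j l
    using that dist by (simp add: simple_root_def nth_eq_iff_index_eq)
  have uc: "(\<Sum>j<?n. u i j * c j l) = - (if i = l then 1 else if l < i then ?k i l else 0)"
    if i: "i < ?n" and l: "l < ?n" for i l
  proof -
    have "c i l = (if i = l then 1 else 0)
        - (\<Sum>j<?n. ?k i j * (if i < j then c j l else if j = l then 1 else 0))"
      using coxeter_nth[OF order i, of "simple_root (vs ! l)"] i l unfolding c_def
      by (simp add: root cong: if_cong)
    \<comment> \<open>On the left \<open>c\<close> meets only the entries strictly above the diagonal; the first summand on the
      right cancels the term \<open>c i l\<close> that the unit diagonal of \<open>U\<close> adds.\<close>
    also have "(\<Sum>j<?n. ?k i j * (if i < j then c j l else if j = l then 1 else 0))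
        = (\<Sum>j<?n. (if i = j then - c j l else 0) + u i j * c j l
            + (if j = l then if l \<le> i then ?k i l else 0 else 0))"
      by (rule sum.cong) (auto simp: u_def)
    also have "\<dots> = - c i l + (\<Sum>j<?n. u i j * c j l) + (if l \<le> i then ?k i l else 0)"
      using i l by (simp add: sum.distrib)
    finally show ?thesis by (auto simp: cartan_def)
  qed
  define U where "U = mat ?n ?n (\<lambda>(i, j). [:u i j:])"
  define X where "X = map_mat (\<lambda>a. [:a:]) (coxeter_matrix G vs) - [:0, 1:] \<cdot>\<^sub>m 1\<^sub>m ?n"
  have car: "U \<in> carrier_mat ?n ?n" "X \<in> carrier_mat ?n ?n"
    unfolding U_def X_def coxeter_matrix_def by auto
  have "det U = 1"
  proof -
    have "upper_triangular U" by (auto simp: U_def u_def)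
    then have "det U = prod_list (diag_mat U)" using car(1) by (rule det_upper_triangular)
    also have "diag_mat U = map (\<lambda>i. 1) [0..<?n]"
      unfolding diag_mat_def by (auto simp: U_def u_def one_pCons)
    finally show ?thesis by (simp add: map_replicate_const)
  qed
  then have "cox_poly G vs = det U * det X" unfolding cox_poly_def X_def by simp
  also have "\<dots> = det (U * X)" using car by (simp add: det_mult)
  also have "U * X = mat ?n ?n (\<lambda>(i, l). cox_entry G vs (vs ! i) (vs ! l))"
  proof (rule eq_matI)
    fix i l assume "i < dim_row (mat ?n ?n (\<lambda>(i, l). cox_entry G vs (vs ! i) (vs ! l)))"
      "l < dim_col (mat ?n ?n (\<lambda>(i, l). cox_entry G vs (vs ! i) (vs ! l)))"
    then have i: "i < ?n" and l: "l < ?n" by auto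
    have X_entry: "X $$ (j, l) = [:c j l:] - (if j = l then [:0, 1:] else 0)" if "j < ?n" for j
      using that l by (simp add: X_def coxeter_matrix_def c_def one_pCons)
    have "(U * X) $$ (i, l) = (\<Sum>j<?n. U $$ (i, j) * X $$ (j, l))"
      using i l car by (simp add: scalar_prod_def atLeast0LessThan)
    also have "\<dots> = (\<Sum>j<?n. [:u i j:] * ([:c j l:] - (if j = l then [:0, 1:] else 0)))"
      using i by (intro sum.cong) (auto simp: U_def X_entry)
    also have "\<dots> = (\<Sum>j<?n. [:u i j * c j l:] - (if j = l then [:0, u i l:] else 0))"
      by (rule sum.cong) (auto simp: algebra_simps)
    also have "\<dots> = [:\<Sum>j<?n. u i j * c j l:] - [:0, u i l:]"
      using l by (simp add: sum_subtractf sum_const_poly)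
    also have "\<dots> = cox_entry G vs (vs ! i) (vs ! l)"
      using i l dist uc[OF i l]
      by (auto simp: cox_entry_def before_nth nth_eq_iff_index_eq u_def cartan_def one_pCons)
    finally show "(U * X) $$ (i, l)
        = mat ?n ?n (\<lambda>(i, l). cox_entry G vs (vs ! i) (vs ! l)) $$ (i, l)"
      using i l by simp
  qed (use car in auto)
  also have "det \<dots> = set_det (set vs) (cox_entry G vs)"
    using dist by (rule det_eq_set_det)
  finally show ?thesis by (simp add: set)
qed

section \<open>Forests and splitting edges\<close>

lemma before_asym:
  assumes "vertex_order G vs" "u \<in> verts G" "w \<in> verts G" "u \<noteq> w"
  shows "before vs u w \<longleftrightarrow> \<not> before vs w u"
proof -
  obtain i j where "i < length vs" "vs ! i = u" "j < length vs" "vs ! j = w"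
    using assms unfolding vertex_order_def by (metis in_set_conv_nth)
  then show ?thesis
    using assms before_nth[of vs i j] before_nth[of vs j i]
    by (auto simp: vertex_order_def)
qed

text \<open>
  Exactly one of the two entries carries the factor \<open>\<lambda>\<close>; which one it is depends on the order, but
  the product does not.
\<close>

lemma cox_entry_prod:
  assumes "vertex_order G vs" "u \<in> verts G" "w \<in> verts G" "u \<noteq> w"
  shows "cox_entry G vs u w * cox_entry G vs w u
    = Polynomial.smult (real (wt G u w) * real (wt G w u)) [:0, 1:]"
  using before_asym[OF assms] assms(4) by (auto simp: cox_entry_def mult_ac)

text \<open>
  Independence of the order, in the form in which it is used: an induced subgraph of a forest may be
  computed with the matrix of the order \<open>vs\<close> of the whole forest, whatever order \<open>ws\<close> it comes with.
\<close>

lemma cox_poly_subgraph: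
  assumes fin: "finite (verts G)" and forest: "\<nexists>cs. is_cycle G cs"
    and order: "vertex_order G vs" and order': "vertex_order H ws"
    and sub: "verts H \<subseteq> verts G"
    and wts: "\<And>u w. u \<in> verts H \<Longrightarrow> w \<in> verts H \<Longrightarrow> u \<noteq> w \<Longrightarrow> wt H u w = wt G u w"
  shows "cox_poly H ws = set_det (verts H) (cox_entry G vs)"
  unfolding cox_poly_eq_set_det[OF order']
proof (rule set_det_cong_acyclic)
  show "finite (verts H)" using fin sub by (rule rev_finite_subset)
  show "cox_entry H ws u u = cox_entry G vs u u" for u by (simp add: cox_entry_def)
  show "cox_entry H ws u w * cox_entry H ws w u = cox_entry G vs u w * cox_entry G vs w u"
    if "u \<in> verts H" "w \<in> verts H" "u \<noteq> w" for u w
    using that cox_entry_prod[OF order subsetD[OF sub] subsetD[OF sub], of u w]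
      cox_entry_prod[OF order', of u w] wts[of u w] wts[of w u] by simp
next
  fix cs assume cs: "3 \<le> length cs" "distinct cs" "set cs \<subseteq> verts H"
  then obtain i where i: "i < length cs" and nadj: "\<not> adj G (cs ! i) (cs ! (Suc i mod length cs))"
    using forest by (auto simp: is_cycle_def)
  let ?j = "Suc i mod length cs"
  have j: "?j < length cs" "i \<noteq> ?j"
    using i cs(1) by (auto simp: mod_Suc)
  have ne: "cs ! i \<noteq> cs ! ?j" using i j cs(2) by (simp add: nth_eq_iff_index_eq)
  have mem: "cs ! i \<in> verts H" "cs ! ?j \<in> verts H" using i j(1) cs(3) by (auto dest: nth_mem)
  have "wt G (cs ! i) (cs ! ?j) = 0" using nadj mem sub ne by (auto simp: adj_def)
  with wts[OF mem ne] ne i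
  show "\<exists>i<length cs. cox_entry H ws (cs ! i) (cs ! (Suc i mod length cs)) = 0
      \<and> cox_entry G vs (cs ! i) (cs ! (Suc i mod length cs)) = 0"
    by (intro exI[of _ i]) (simp add: cox_entry_def)
qed

text \<open>
  Symmetry of the form gives \<open>d\<^sub>a\<^sub>b (a, a) = d\<^sub>b\<^sub>a (b, b)\<close>. If \<open>d\<^sub>a\<^sub>b = 1\<close> then \<open>a\<close> is at least as long as \<open>b\<close>,
  and the ratio of the squared lengths is \<open>d\<^sub>b\<^sub>a\<close>; the other case is symmetric.
\<close>

lemma length_ratio_eq_weight_prod:
  assumes form: "symmetrizing_form G B" and adj: "adj G a b" "adj G b a"
    and one: "wt G a b = 1 \<or> wt G b a = 1"
  shows "length_ratio B a b = real (wt G a b) * real (wt G b a)"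
proof -
  have pos: "0 < B a a" "0 < B b b" and sym: "B a b = B b a" and "a \<noteq> b"
    and k: "cartan G a b = 2 * B a b / B a a" "cartan G b a = 2 * B b a / B b b"
    using form adj unfolding symmetrizing_form_def adj_def by blast+
  then have eq: "real (wt G a b) * B a a = real (wt G b a) * B b b"
    by (simp add: cartan_def field_simps)
  have ge: "1 \<le> real (wt G a b)" "1 \<le> real (wt G b a)" using adj by (auto simp: adj_def)
  from one show ?thesis
  proof
    assume w: "wt G a b = 1"
    then have aa: "B a a = real (wt G b a) * B b b" using eq by simp
    then have "B b b \<le> B a a" using ge pos by simp
    then show ?thesis using aa w pos by (simp add: length_ratio_def)
  next
    assume w: "wt G b a = 1"
    then have bb: "B b b = real (wt G a b) * B a a" using eq by simp
    then have "B a a \<le> B b b" using ge pos by simp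
    then show ?thesis using bb w pos by (simp add: length_ratio_def)
  qed
qed

text \<open>
  A path that starts in \<open>a\<close> either avoids the deleted edge or can be cut at its last passage through
  it, so every vertex remains connected to \<open>a\<close> or to \<open>b\<close>. A vertex connected to both, or another edge
  between the two sides, would connect \<open>a\<close> to \<open>b\<close> after the deletion.
\<close>

lemma splitting_edge_components:
  assumes graph: "valued_graph G" and conn: "\<forall>u\<in>verts G. \<forall>v\<in>verts G. (adj G)\<^sup>*\<^sup>* u v"
    and split: "splitting_edge G a b"
  defines "S \<equiv> verts (component (delete_edge G a b) a)"
    and "T \<equiv> verts (component (delete_edge G a b) b)"
  shows "S \<union> T = verts G" "S \<inter> T = {}" "a \<in> S" "b \<in> T"
    and "\<And>u v. u \<in> S \<Longrightarrow> v \<in> T \<Longrightarrow> (u, v) \<noteq> (a, b) \<Longrightarrow> wt G u v = 0 \<and> wt G v u = 0"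
proof -
  let ?E = "adj (delete_edge G a b)"
  have ab: "a \<in> verts G" "b \<in> verts G" "\<not> ?E\<^sup>*\<^sup>* a b"
    using split by (auto simp: splitting_edge_def adj_def)
  have S: "S = {u \<in> verts G. ?E\<^sup>*\<^sup>* a u}" and T: "T = {u \<in> verts G. ?E\<^sup>*\<^sup>* b u}"
    by (auto simp: S_def T_def component_def delete_edge_def)
  have sym: "?E v u" if "?E u v" for u v
  proof -
    have uv: "u \<in> verts G" "v \<in> verts G" "u \<noteq> v" "wt G u v \<noteq> 0"
        "\<not> (u = a \<and> v = b \<or> u = b \<and> v = a)"
      using that by (auto simp: adj_def delete_edge_def split: if_splits)
    then have "wt G v u \<noteq> 0" using graph by (auto simp: valued_graph_def)
    then show ?thesis using uv by (auto simp: adj_def delete_edge_def)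
  qed
  have sym': "?E\<^sup>*\<^sup>* v u" if "?E\<^sup>*\<^sup>* u v" for u v
    using that by (induction rule: rtranclp_induct) (auto intro: sym converse_rtranclp_into_rtranclp)
  show "a \<in> S" "b \<in> T" using ab by (auto simp: S T)
  show disj: "S \<inter> T = {}" using ab(3) sym' by (auto simp: S T dest: rtranclp_trans)
  have "?E\<^sup>*\<^sup>* a u \<or> ?E\<^sup>*\<^sup>* b u" if "(adj G)\<^sup>*\<^sup>* a u" for u
    using that
  proof (induction rule: rtranclp_induct)
    case (step u v)
    have "?E u v \<or> v = a \<or> v = b"
      using step.hyps(2) by (auto simp: adj_def delete_edge_def)
    then show ?case using step.IH by (auto intro: rtranclp.rtrancl_into_rtrancl)
  qed auto
  then show "S \<union> T = verts G" using conn ab by (auto simp: S T)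
  fix u v assume uv: "u \<in> S" "v \<in> T" "(u, v) \<noteq> (a, b)"
  have "\<not> ?E u v" 
    using uv disj by (auto simp: S T dest: rtranclp.rtrancl_into_rtrancl)
  then have "\<not> adj G u v"
    using uv disj \<open>a \<in> S\<close> \<open>b \<in> T\<close> by (auto simp: adj_def delete_edge_def split: if_splits)
  then have "wt G u v = 0" using uv disj by (auto simp: adj_def S T)
  then show "wt G u v = 0 \<and> wt G v u = 0"
    using graph uv disj by (auto simp: valued_graph_def S T)
qed

theorem proposition4p8:
  fixes \<Gamma> \<Gamma>\<^sub>1 \<Gamma>\<^sub>2 :: "'v valued_graph"
    and \<alpha> \<beta> :: 'v
    and B :: "'v \<Rightarrow> 'v \<Rightarrow> real"
    and \<rho> :: real
    and vs vs1 vs2 us1 us2 :: "'v list"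
  assumes tree: "valued_tree \<Gamma>"
    and form: "symmetrizing_form \<Gamma> B"
    and splitting: "splitting_edge \<Gamma> \<alpha> \<beta>"
    and weighted: "weighted_edge \<Gamma> \<alpha> \<beta>"
    and weight_one: "wt \<Gamma> \<alpha> \<beta> = 1 \<or> wt \<Gamma> \<beta> \<alpha> = 1"
    and lengths: "B \<alpha> \<alpha> \<noteq> B \<beta> \<beta>"
    and rho: "\<rho> = length_ratio B \<alpha> \<beta>"
    and part1: "\<Gamma>\<^sub>1 = component (delete_edge \<Gamma> \<alpha> \<beta>) \<alpha>"
    and part2: "\<Gamma>\<^sub>2 = component (delete_edge \<Gamma> \<alpha> \<beta>) \<beta>"
    and order: "vertex_order \<Gamma> vs"
    and order1: "vertex_order \<Gamma>\<^sub>1 vs1"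
    and order2: "vertex_order \<Gamma>\<^sub>2 vs2"
    and order1': "vertex_order (delete_vertex \<Gamma>\<^sub>1 \<alpha>) us1"
    and order2': "vertex_order (delete_vertex \<Gamma>\<^sub>2 \<beta>) us2"
  shows "cox_poly \<Gamma> vs = cox_poly \<Gamma>\<^sub>1 vs1 * cox_poly \<Gamma>\<^sub>2 vs2
           - Polynomial.smult \<rho> ([:0, 1:] * cox_poly (delete_vertex \<Gamma>\<^sub>1 \<alpha>) us1
                               * cox_poly (delete_vertex \<Gamma>\<^sub>2 \<beta>) us2)"
proof -
  let ?S = "verts \<Gamma>\<^sub>1" and ?T = "verts \<Gamma>\<^sub>2" and ?M = "cox_entry \<Gamma> vs"
  have graph: "valued_graph \<Gamma>" and conn: "\<forall>u\<in>verts \<Gamma>. \<forall>v\<in>verts \<Gamma>. (adj \<Gamma>)\<^sup>*\<^sup>* u v"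
    and forest: "\<nexists>cs. is_cycle \<Gamma> cs"
    using tree by (auto simp: valued_tree_def)
  have fin: "finite (verts \<Gamma>)" using graph by (simp add: valued_graph_def)
  note comps = splitting_edge_components[OF graph conn splitting, folded part1 part2]
  have finST: "finite ?S" "finite ?T" using fin comps(1) by (metis finite_Un)+
  have adj: "adj \<Gamma> \<alpha> \<beta>" "adj \<Gamma> \<beta> \<alpha>"
    using splitting graph by (auto simp: splitting_edge_def adj_def valued_graph_def)
  have wt1: "wt \<Gamma>\<^sub>1 u w = wt \<Gamma> u w" if "u \<in> ?S" "w \<in> ?S" for u w
    using that comps by (auto simp: part1 component_def delete_edge_def)
  have wt2: "wt \<Gamma>\<^sub>2 u w = wt \<Gamma> u w" if "u \<in> ?T" "w \<in> ?T" for u w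
    using that comps by (auto simp: part2 component_def delete_edge_def)
  note sub = cox_poly_subgraph[OF fin forest order]
  have X1: "cox_poly \<Gamma>\<^sub>1 vs1 = set_det ?S ?M"
    using comps(1) wt1 by (intro sub order1) auto
  have X2: "cox_poly \<Gamma>\<^sub>2 vs2 = set_det ?T ?M"
    using comps(1) wt2 by (intro sub order2) auto
  have "cox_poly (delete_vertex \<Gamma>\<^sub>1 \<alpha>) us1 = set_det (verts (delete_vertex \<Gamma>\<^sub>1 \<alpha>)) ?M"
    using comps(1) wt1 by (intro sub order1') (auto simp: delete_vertex_def)
  then have X1': "cox_poly (delete_vertex \<Gamma>\<^sub>1 \<alpha>) us1 = set_det (?S - {\<alpha>}) ?M"
    by (simp add: delete_vertex_def)
  have "cox_poly (delete_vertex \<Gamma>\<^sub>2 \<beta>) us2 = set_det (verts (delete_vertex \<Gamma>\<^sub>2 \<beta>)) ?M"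
    using comps(1) wt2 by (intro sub order2') (auto simp: delete_vertex_def)
  then have X2': "cox_poly (delete_vertex \<Gamma>\<^sub>2 \<beta>) us2 = set_det (?T - {\<beta>}) ?M"
    by (simp add: delete_vertex_def)
  have "cox_poly \<Gamma> vs = set_det (?S \<union> ?T) ?M"
    by (simp add: cox_poly_eq_set_det[OF order] comps(1))
  also have "\<dots> = set_det ?S ?M * set_det ?T ?M
      - ?M \<alpha> \<beta> * ?M \<beta> \<alpha> * set_det (?S - {\<alpha>}) ?M * set_det (?T - {\<beta>}) ?M"
    using comps(2) comps(5)
    by (intro set_det_two_blocks_one_edge finST comps) (auto simp: cox_entry_def)
  also have "?M \<alpha> \<beta> * ?M \<beta> \<alpha> = Polynomial.smult \<rho> [:0, 1:]"
    using cox_entry_prod[OF order, of \<alpha> \<beta>] adj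
      length_ratio_eq_weight_prod[OF form adj weight_one]
    by (simp add: adj_def rho)
  finally show ?thesis by (simp add: X1 X2 X1' X2')
qed

end
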